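(* $SI_{\mathrm{red}}$ is not continuous. That is, there exist finite sets $\mathcal S,\mathcal Y,\mathcal Z$ such that the function $P\mapsto SI_{\mathrm{red}}(S;Y,Z)$ on the probability simplex of all joint distributions $P$ on $\mathcal S\times\mathcal Y\times\mathcal Z$ is not continuous.
   Context: $S,Y,Z$ are random variables with finite state spaces $\mathcal S,\mathcal Y,\mathcal Z$ and joint distribution $P$. Continuity is with respect to the canonical (Euclidean) topology of the probability simplex over $\mathcal S\times\mathcal Y\times\mathcal Z$. $D(\cdot\|\cdot)$ is the Kullback–Leibler divergence. With $\mathcal Z'=\{z\in\mathcal Z:P(Z=z)>0\}$, define for $y$ with $P(y)>0$ $$P_{S|y\searrow Z}=\arg\min_{Q\in\mathrm{conv}\{P(S|z):z\in\mathcal Z'\}}D(P(S|y)\|Q),$$ $$I_S(y\searrow Z)=D(P(S|y)\|P(S))-D(P(S|y)\|P_{S|y\searrow Z}),\qquad I_S(Y\searrow Z)=\sum_{y}P(y)\,I_S(y\searrow Z),$$ where $\mathrm{conv}$ denotes the convex hull and the last sum is over $y$ with $P(y)>0$. $I_S(Z\searrow Y)$ is defined analogously with the roles of $Y$ and $Z$ exchanged. Then $SI_{\mathrm{red}}(S;Y,Z)=\min\{I_S(Y\searrow Z),\,I_S(Z\searrow Y)\}$. *)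

theory Defs
  imports "HOL-Probability.Probability" "HOL-Library.Function_Algebras"
begin

text \<open>
  Distributions on finite sets are represented by their mass functions, extended by zero outside
  the set. The pointwise vector space structure makes the library's \<^term>\<open>(hull) convex\<close>
  available for them.
\<close>

instantiation "fun" :: (type, real_vector) real_vector
begin

definition scaleR_fun :: "real \<Rightarrow> ('a \<Rightarrow> 'b) \<Rightarrow> 'a \<Rightarrow> 'b"
  where "scaleR_fun c f = (\<lambda>x. c *\<^sub>R f x)"

instance
  by standard (auto simp: scaleR_fun_def fun_eq_iff scaleR_add_right scaleR_add_left)

end

text \<open>
  The type class topology on functions is the product topology. On mass functions vanishing
  outside the finite set \<open>A\<close> it agrees with the Euclidean topology of the simplex.
\<close>

definition prob_simplex :: "'a set \<Rightarrow> ('a \<Rightarrow> real) set"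
  where "prob_simplex A =
    {p. (\<forall>x\<in>A. 0 \<le> p x) \<and> (\<forall>x. x \<notin> A \<longrightarrow> p x = 0) \<and> (\<Sum>x\<in>A. p x) = 1}"

text \<open>
  The divergence $D(p \| q)$ of mass functions on \<open>A\<close>. The library's \<^const>\<open>KL_divergence\<close>
  takes the reference measure first and is meaningful only in the absolutely continuous case;
  otherwise the divergence is infinite. The base of the logarithm (here 2) only rescales everything
  by a positive constant.
\<close>

definition rel_entropy :: "'a set \<Rightarrow> ('a \<Rightarrow> real) \<Rightarrow> ('a \<Rightarrow> real) \<Rightarrow> ereal"
  where "rel_entropy A p q =
    (let P = point_measure A (\<lambda>x. ennreal (p x)); Q = point_measure A (\<lambda>x. ennreal (q x))
     in if absolutely_continuous Q P then ereal (KL_divergence 2 Q P) else \<infinity>)"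

lemma rel_entropy_finite:
  assumes A: "finite A" and p: "\<And>x. x \<in> A \<Longrightarrow> 0 \<le> p x" and q: "\<And>x. x \<in> A \<Longrightarrow> 0 \<le> q x"
  shows "rel_entropy A p q =
    (if \<forall>x\<in>A. q x = 0 \<longrightarrow> p x = 0 then ereal (\<Sum>x\<in>A. p x * log 2 (p x / q x)) else \<infinity>)"
proof -
  have null: "X \<in> null_sets (point_measure A (\<lambda>x. ennreal (f x))) \<longleftrightarrow> X \<subseteq> A \<and> (\<forall>x\<in>X. f x = 0)"
    if f: "\<And>x. x \<in> A \<Longrightarrow> 0 \<le> f x" for X and f :: "'a \<Rightarrow> real"
  proof (cases "X \<subseteq> A")
    case True
    then have "finite X" using A finite_subset by blast
    have "(\<Sum>x\<in>X. ennreal (f x)) = 0 \<longleftrightarrow> (\<forall>x\<in>X. f x = 0)"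
    proof -
      have "(\<Sum>x\<in>X. ennreal (f x)) = 0 \<longleftrightarrow> (\<forall>x\<in>X. ennreal (f x) = 0)"
        using \<open>finite X\<close> by simp
      also have "\<dots> \<longleftrightarrow> (\<forall>x\<in>X. f x = 0)"
        using True f by (intro ball_cong refl) (metis ennreal_eq_0_iff order_antisym order_refl subsetD)
      finally show ?thesis .
    qed
    then show ?thesis
      using A True by (simp add: null_sets_def sets_point_measure emeasure_point_measure_finite)
  qed (auto simp: null_sets_def sets_point_measure)
  have ac: "absolutely_continuous (point_measure A (\<lambda>x. ennreal (q x)))
      (point_measure A (\<lambda>x. ennreal (p x))) \<longleftrightarrow> (\<forall>x\<in>A. q x = 0 \<longrightarrow> p x = 0)"
    (is "?ac \<longleftrightarrow> ?R")
  proof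
    assume ?ac
    then have "{x} \<in> null_sets (point_measure A (\<lambda>x. ennreal (p x)))" if "x \<in> A" "q x = 0" for x
    proof -
      have "{x} \<in> null_sets (point_measure A (\<lambda>x. ennreal (q x)))"
        using that by (subst null[OF q]) auto
      with \<open>?ac\<close> show ?thesis
        by (auto simp: absolutely_continuous_def)
    qed
    then show ?R
      by (subst (asm) null[OF p]) auto
  next
    assume ?R
    then show ?ac
      unfolding absolutely_continuous_def by (intro subsetI) (simp add: null[OF p] null[OF q] subset_iff)
  qed
  interpret sigma_finite_measure "count_space A"
    using A by (rule sigma_finite_measure_count_space_finite)
  have "KL_divergence 2 (point_measure A (\<lambda>x. ennreal (q x))) (point_measure A (\<lambda>x. ennreal (p x)))
      = (\<Sum>x\<in>A. p x * log 2 (p x / q x))" if ?R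
    unfolding point_measure_def using A p q that
    by (subst KL_density_density) (auto simp: AE_count_space lebesgue_integral_count_space_finite)
  then show ?thesis
    by (auto simp: rel_entropy_def Let_def ac)
qed

definition marg1 :: "'y set \<Rightarrow> 'z set \<Rightarrow> ('s \<times> 'y \<times> 'z \<Rightarrow> real) \<Rightarrow> 's \<Rightarrow> real"
  where "marg1 Y Z P s = (\<Sum>y\<in>Y. \<Sum>z\<in>Z. P (s, y, z))"

definition marg2 :: "'s set \<Rightarrow> 'z set \<Rightarrow> ('s \<times> 'y \<times> 'z \<Rightarrow> real) \<Rightarrow> 'y \<Rightarrow> real"
  where "marg2 S Z P y = (\<Sum>s\<in>S. \<Sum>z\<in>Z. P (s, y, z))"

definition marg3 :: "'s set \<Rightarrow> 'y set \<Rightarrow> ('s \<times> 'y \<times> 'z \<Rightarrow> real) \<Rightarrow> 'z \<Rightarrow> real"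
  where "marg3 S Y P z = (\<Sum>s\<in>S. \<Sum>y\<in>Y. P (s, y, z))"

definition cond12 :: "'s set \<Rightarrow> 'z set \<Rightarrow> ('s \<times> 'y \<times> 'z \<Rightarrow> real) \<Rightarrow> 'y \<Rightarrow> 's \<Rightarrow> real"
  where "cond12 S Z P y s = (\<Sum>z\<in>Z. P (s, y, z)) / marg2 S Z P y"

definition cond13 :: "'s set \<Rightarrow> 'y set \<Rightarrow> ('s \<times> 'y \<times> 'z \<Rightarrow> real) \<Rightarrow> 'z \<Rightarrow> 's \<Rightarrow> real"
  where "cond13 S Y P z s = (\<Sum>y\<in>Y. P (s, y, z)) / marg3 S Y P z"

text \<open>
  The projection $P_{S|y \searrow Z}$. The minimiser need not be unique, but only its divergence,
  which does not depend on the choice, is used below.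
\<close>

definition proj_cond ::
    "'s set \<Rightarrow> 'y set \<Rightarrow> 'z set \<Rightarrow> ('s \<times> 'y \<times> 'z \<Rightarrow> real) \<Rightarrow> 'y \<Rightarrow> 's \<Rightarrow> real"
  where "proj_cond S Y Z P y =
    arg_min_on (\<lambda>Q. rel_entropy S (cond12 S Z P y) Q)
      (convex hull (cond13 S Y P ` {z\<in>Z. marg3 S Y P z > 0}))"

text \<open>
  Both divergences below are finite when $P(y) > 0$: the support of $P(S|y)$ is contained in that
  of $P(S)$, and $P(S)$ lies in the convex hull over which the projection minimises.
\<close>

definition proj_info_at ::
    "'s set \<Rightarrow> 'y set \<Rightarrow> 'z set \<Rightarrow> ('s \<times> 'y \<times> 'z \<Rightarrow> real) \<Rightarrow> 'y \<Rightarrow> real"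
  where "proj_info_at S Y Z P y =
    real_of_ereal (rel_entropy S (cond12 S Z P y) (marg1 Y Z P)) -
    real_of_ereal (rel_entropy S (cond12 S Z P y) (proj_cond S Y Z P y))"

definition proj_info ::
    "'s set \<Rightarrow> 'y set \<Rightarrow> 'z set \<Rightarrow> ('s \<times> 'y \<times> 'z \<Rightarrow> real) \<Rightarrow> real"
  where "proj_info S Y Z P =
    (\<Sum>y\<in>{y\<in>Y. marg2 S Z P y > 0}. marg2 S Z P y * proj_info_at S Y Z P y)"

definition SI_red ::
    "'s set \<Rightarrow> 'y set \<Rightarrow> 'z set \<Rightarrow> ('s \<times> 'y \<times> 'z \<Rightarrow> real) \<Rightarrow> real"
  where "SI_red S Y Z P =
    min (proj_info S Y Z P) (proj_info S Z Y (\<lambda>(s, z, y). P (s, y, z)))"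

end

theory Submission
  imports Defs
begin

text \<open>
  The convex hull in the projection jumps when a value of \<open>Z\<close> of arbitrarily small probability
  appears. Start from \<open>Y\<close>, \<open>Z\<close> that carry information about \<open>S\<close> in orthogonal directions,
  $\sum_s P(s|y) P(s|z) / P(s) = 1$ for all $y, z$: then every $P(S|y)$ projects to $P(S)$ and the
  projected information vanishes. Now let \<open>Y\<close> and \<open>Z\<close> both reveal \<open>S\<close> with a small probability
  $e$. Both hulls become the full simplex, so the projected informations equal the mutual
  informations $I(S;Y)$ and $I(S;Z)$, which stay away from \<open>0\<close> as $e \to 0$.
\<close>

section \<open>Mass functions on a finite set and their divergence\<close>

lemma sum_fun_apply: "(\<Sum>i\<in>I. f i) x = (\<Sum>i\<in>I. f i x)"
  by (induction I rule: infinite_finite_induct) auto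

lemma sum_prod3:
  "(\<Sum>x\<in>A \<times> B \<times> C. f x) = (\<Sum>a\<in>A. \<Sum>b\<in>B. \<Sum>c\<in>C. f (a, b, c))"
  by (simp add: sum.cartesian_product)

lemma convex_prob_simplex: "convex (prob_simplex A)"
  by (auto simp: convex_def prob_simplex_def scaleR_fun_def sum.distrib simp flip: sum_distrib_left)

text \<open>First-order optimality criterion: via $\ln x \le x - 1$, a nonpositive derivative of
  $\sum_x p(x) \ln q(x)$ in the direction $Q - q$ already gives the inequality.\<close>

lemma rel_entropy_le:
  assumes A: "finite A" and p: "p \<in> prob_simplex A" and q: "q \<in> prob_simplex A"
    and Q: "Q \<in> prob_simplex A" and ac: "\<And>x. x \<in> A \<Longrightarrow> q x = 0 \<Longrightarrow> p x = 0"
    and le: "(\<Sum>x\<in>A. p x * Q x / q x) \<le> 1"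
  shows "rel_entropy A p q \<le> rel_entropy A p Q"
proof (cases "\<forall>x\<in>A. Q x = 0 \<longrightarrow> p x = 0")
  case True
  have nn: "0 \<le> p x" "0 \<le> q x" "0 \<le> Q x" if "x \<in> A" for x
    using that p q Q by (auto simp: prob_simplex_def)
  have "(\<Sum>x\<in>A. p x * log 2 (p x / q x)) - (\<Sum>x\<in>A. p x * log 2 (p x / Q x))
      \<le> (\<Sum>x\<in>A. (p x * Q x / q x - p x) / ln 2)"
    unfolding sum_subtractf[symmetric]
  proof (rule sum_mono)
    fix x assume x: "x \<in> A"
    show "p x * log 2 (p x / q x) - p x * log 2 (p x / Q x) \<le> (p x * Q x / q x - p x) / ln 2"
    proof (cases "p x = 0")
      case False
      then have pos: "0 < p x" "0 < q x" "0 < Q x"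
        using nn[OF x] ac[OF x] True x by force+
      have "p x * log 2 (p x / q x) - p x * log 2 (p x / Q x) = p x * ln (Q x / q x) / ln 2"
        using pos by (simp add: log_def ln_div field_simps)
      also have "\<dots> \<le> p x * (Q x / q x - 1) / ln 2"
        using pos by (intro divide_right_mono mult_left_mono ln_le_minus_one) auto
      finally show ?thesis by (simp add: algebra_simps)
    qed simp
  qed
  also have "\<dots> = ((\<Sum>x\<in>A. p x * Q x / q x) - (\<Sum>x\<in>A. p x)) / ln 2"
    by (simp add: sum_subtractf flip: sum_divide_distrib)
  also have "\<dots> \<le> 0"
    using le p by (simp add: prob_simplex_def divide_nonpos_pos)
  finally show ?thesis
    using A nn ac True by (simp add: rel_entropy_finite)
next
  case False
  have "rel_entropy A p Q = \<infinity>"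
    using A p Q False by (subst rel_entropy_finite) (auto simp: prob_simplex_def)
  then show ?thesis by simp
qed

lemma rel_entropy_self:
  assumes "finite A" "p \<in> prob_simplex A"
  shows "rel_entropy A p p = 0"
proof -
  have "(\<Sum>x\<in>A. p x * log 2 (p x / p x)) = 0"
    by (intro sum.neutral) auto
  then show ?thesis
    using assms by (subst rel_entropy_finite) (auto simp: prob_simplex_def zero_ereal_def)
qed

text \<open>Gibbs' inequality: the optimality criterion with \<open>p\<close> itself as candidate
  minimiser, whose divergence is \<open>0\<close>.\<close>

lemma rel_entropy_nonneg:
  assumes A: "finite A" and p: "p \<in> prob_simplex A" and q: "q \<in> prob_simplex A"
  shows "0 \<le> rel_entropy A p q"
proof -
  \<comment> \<open>Only an inequality: where \<open>p x = 0\<close>, the left term is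
    \<open>0\<close> while \<open>q x\<close> may be positive.\<close>
  have "(\<Sum>x\<in>A. p x * q x / p x) \<le> (\<Sum>x\<in>A. q x)"
    using q by (intro sum_mono) (auto simp: prob_simplex_def)
  also have "\<dots> = 1"
    using q by (simp add: prob_simplex_def)
  finally have "rel_entropy A p p \<le> rel_entropy A p q"
    by (intro rel_entropy_le[OF A p p q]) auto
  then show ?thesis
    using rel_entropy_self[OF A p] by simp
qed

section \<open>Marginals and conditionals as points of the simplex\<close>

lemma marg1_prob_simplex:
  assumes "P \<in> prob_simplex (S \<times> Y \<times> Z)"
  shows "marg1 Y Z P \<in> prob_simplex S"
  using assms by (auto simp: prob_simplex_def marg1_def sum_prod3 intro!: sum_nonneg sum.neutral)

lemma cond12_prob_simplex:
  assumes P: "P \<in> prob_simplex (S \<times> Y \<times> Z)" and y: "y \<in> Y" "marg2 S Z P y > 0"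
  shows "cond12 S Z P y \<in> prob_simplex S"
proof -
  have "(\<Sum>s\<in>S. cond12 S Z P y s) = 1"
    using y by (simp add: cond12_def marg2_def flip: sum_divide_distrib)
  then show ?thesis
    using P y by (auto simp: prob_simplex_def cond12_def intro!: sum_nonneg divide_nonneg_pos)
qed

lemma cond13_prob_simplex:
  assumes P: "P \<in> prob_simplex (S \<times> Y \<times> Z)" and z: "z \<in> Z" "marg3 S Y P z > 0"
  shows "cond13 S Y P z \<in> prob_simplex S"
proof -
  have "(\<Sum>s\<in>S. cond13 S Y P z s) = 1"
    using z by (simp add: cond13_def marg3_def flip: sum_divide_distrib)
  then show ?thesis
    using P z by (auto simp: prob_simplex_def cond13_def intro!: sum_nonneg divide_nonneg_pos)
qed

lemma hull_cond13_subset_prob_simplex: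
  assumes "P \<in> prob_simplex (S \<times> Y \<times> Z)"
  shows "convex hull (cond13 S Y P ` {z\<in>Z. marg3 S Y P z > 0}) \<subseteq> prob_simplex S"
  using cond13_prob_simplex[OF assms] by (intro hull_minimal convex_prob_simplex) auto

text \<open>Law of total probability: P(S) is the mixture of the P(S|z) with weights P(z). This
  makes P(S) a candidate in the minimisation.\<close>

lemma marg1_in_hull_cond13:
  assumes S: "finite S" and Y: "finite Y" and Z: "finite Z"
    and P: "P \<in> prob_simplex (S \<times> Y \<times> Z)"
  shows "marg1 Y Z P \<in> convex hull (cond13 S Y P ` {z\<in>Z. marg3 S Y P z > 0})"
    (is "_ \<in> convex hull (_ ` ?Z)")
proof -
  have nn: "0 \<le> P (s, y, z)" if "s \<in> S" "y \<in> Y" "z \<in> Z" for s y z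
    using P that by (auto simp: prob_simplex_def)
  have out: "P (s, y, z) = 0" if "s \<notin> S" for s y z
    using P that by (auto simp: prob_simplex_def)
  have m_nn: "0 \<le> marg3 S Y P z" if "z \<in> Z" for z
    unfolding marg3_def using nn that by (intro sum_nonneg) auto
  \<comment> \<open>Values z of probability zero contribute nothing, so the mixture may be
    restricted to those z whose conditional distribution is defined.\<close>
  have null: "(\<Sum>y\<in>Y. P (s, y, z)) = 0" if "z \<in> Z" "\<not> marg3 S Y P z > 0" for s z
  proof (cases "s \<in> S")
    case True
    have "(\<Sum>s\<in>S. \<Sum>y\<in>Y. P (s, y, z)) = 0"
      using m_nn[of z] that by (simp add: marg3_def)
    then show ?thesis
      using True S nn that by (subst (asm) sum_nonneg_eq_0_iff) (auto intro!: sum_nonneg)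
  qed (simp add: out)
  have "marg1 Y Z P s = (\<Sum>z\<in>?Z. marg3 S Y P z *\<^sub>R cond13 S Y P z) s" for s
  proof -
    have "marg1 Y Z P s = (\<Sum>z\<in>Z. \<Sum>y\<in>Y. P (s, y, z))"
      unfolding marg1_def by (rule sum.swap)
    also have "\<dots> = (\<Sum>z\<in>?Z. \<Sum>y\<in>Y. P (s, y, z))"
      using Z null by (intro sum.mono_neutral_right) auto
    also have "\<dots> = (\<Sum>z\<in>?Z. marg3 S Y P z *\<^sub>R cond13 S Y P z) s"
      unfolding sum_fun_apply by (intro sum.cong) (auto simp: scaleR_fun_def cond13_def)
    finally show ?thesis .
  qed
  then have eq: "marg1 Y Z P = (\<Sum>z\<in>?Z. marg3 S Y P z *\<^sub>R cond13 S Y P z)"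
    by blast
  have "(\<Sum>z\<in>?Z. marg3 S Y P z) = (\<Sum>z\<in>Z. marg3 S Y P z)"
    using Z m_nn by (intro sum.mono_neutral_left) (auto simp: not_less intro: antisym)
  also have "\<dots> = (\<Sum>s\<in>S. marg1 Y Z P s)"
    unfolding marg3_def marg1_def
    by (subst sum.swap) (intro sum.cong refl sum.swap)
  also have "\<dots> = 1"
    using marg1_prob_simplex[OF P] by (simp add: prob_simplex_def)
  finally show ?thesis
    unfolding eq using Z by (intro convex_sum) (auto intro: hull_inc)
qed

text \<open>Supplies the absolute continuity that \<open>rel_entropy_le\<close> asks for when its
  candidate minimiser is P(S): P(s) = 0 annihilates every joint mass above s.\<close>

lemma cond12_eq_0:
  assumes fin: "finite S" "finite Y" "finite Z" and P: "P \<in> prob_simplex (S \<times> Y \<times> Z)"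
    and "s \<in> S" "y \<in> Y" "marg1 Y Z P s = 0"
  shows "cond12 S Z P y s = 0"
proof -
  have "0 \<le> P (s, y, z)" if "y \<in> Y" "z \<in> Z" for y z
    using P that \<open>s \<in> S\<close> by (auto simp: prob_simplex_def)
  then show ?thesis
    using assms unfolding marg1_def cond12_def
    by (subst (asm) sum_nonneg_eq_0_iff) (auto intro!: sum_nonneg)
qed

section \<open>Projections onto the hull in two extreme cases\<close>

text \<open>The criterion of \<open>rel_entropy_le\<close> is linear in the competitor Q, so
  checking it at the generators P(S|z) covers the whole hull. Hence P(S) attains the minimum and the
  two divergences cancel.\<close>

lemma proj_info_at_eq_0:
  assumes fin: "finite S" "finite Y" "finite Z" and P: "P \<in> prob_simplex (S \<times> Y \<times> Z)"
    and y: "y \<in> Y" "marg2 S Z P y > 0"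
    and le: "\<And>z. z \<in> Z \<Longrightarrow> marg3 S Y P z > 0 \<Longrightarrow>
      (\<Sum>s\<in>S. cond12 S Z P y s * cond13 S Y P z s / marg1 Y Z P s) \<le> 1"
  shows "proj_info_at S Y Z P y = 0"
proof -
  let ?H = "convex hull (cond13 S Y P ` {z\<in>Z. marg3 S Y P z > 0})"
  let ?L = "\<lambda>Q. \<Sum>s\<in>S. cond12 S Z P y s * Q s / marg1 Y Z P s"
  have "convex {Q. ?L Q \<le> 1}"
  proof (rule convexI)
    fix Q R u v assume "Q \<in> {Q. ?L Q \<le> 1}" "R \<in> {Q. ?L Q \<le> 1}" and uv: "0 \<le> u" "0 \<le> v" "u + v = (1::real)"
    have "?L (u *\<^sub>R Q + v *\<^sub>R R) = u * ?L Q + v * ?L R"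
      unfolding sum_distrib_left sum.distrib[symmetric]
      by (intro sum.cong) (auto simp: scaleR_fun_def add_divide_distrib algebra_simps)
    also have "\<dots> \<le> u * 1 + v * 1"
      using \<open>Q \<in> _\<close> \<open>R \<in> _\<close> uv by (intro add_mono mult_left_mono) auto
    finally show "u *\<^sub>R Q + v *\<^sub>R R \<in> {Q. ?L Q \<le> 1}"
      using uv by simp
  qed
  then have H: "?H \<subseteq> {Q. ?L Q \<le> 1}"
    using le by (intro hull_minimal) auto
  have "rel_entropy S (cond12 S Z P y) (proj_cond S Y Z P y)
      = rel_entropy S (cond12 S Z P y) (marg1 Y Z P)"
    unfolding proj_cond_def arg_min_on_def
  \<comment> \<open>\<open>arg_min_equality\<close> identifies the minimal value, not the minimiser,
    which may fail to be unique.\<close>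
  proof (rule arg_min_equality[where f = "rel_entropy S (cond12 S Z P y)"])
    fix Q assume "Q \<in> ?H"
    then show "rel_entropy S (cond12 S Z P y) (marg1 Y Z P) \<le> rel_entropy S (cond12 S Z P y) Q"
      using H hull_cond13_subset_prob_simplex[OF P] cond12_eq_0[OF fin P _ y(1)]
      by (intro rel_entropy_le cond12_prob_simplex[OF P y] marg1_prob_simplex[OF P] fin) auto
  qed (rule marg1_in_hull_cond13[OF fin P])
  then show ?thesis
    by (simp add: proj_info_at_def)
qed

text \<open>P(S|y) is itself a minimiser, with divergence \<open>0\<close>, so nothing is subtracted
  from the divergence to P(S).\<close>

lemma proj_info_at_eq_rel_entropy:
  assumes S: "finite S" and P: "P \<in> prob_simplex (S \<times> Y \<times> Z)"
    and y: "y \<in> Y" "marg2 S Z P y > 0"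
    and in_hull: "cond12 S Z P y \<in> convex hull (cond13 S Y P ` {z\<in>Z. marg3 S Y P z > 0})"
  shows "proj_info_at S Y Z P y = real_of_ereal (rel_entropy S (cond12 S Z P y) (marg1 Y Z P))"
proof -
  note p = cond12_prob_simplex[OF P y]
  have "rel_entropy S (cond12 S Z P y) (proj_cond S Y Z P y)
      = rel_entropy S (cond12 S Z P y) (cond12 S Z P y)"
    unfolding proj_cond_def arg_min_on_def using in_hull
  proof (rule arg_min_equality[where f = "rel_entropy S (cond12 S Z P y)"])
    fix Q assume "Q \<in> convex hull (cond13 S Y P ` {z\<in>Z. marg3 S Y P z > 0})"
    then show "rel_entropy S (cond12 S Z P y) (cond12 S Z P y) \<le> rel_entropy S (cond12 S Z P y) Q"
      using hull_cond13_subset_prob_simplex[OF P] rel_entropy_nonneg[OF S p]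
      by (auto simp: rel_entropy_self[OF S p])
  qed
  then show ?thesis
    by (simp add: proj_info_at_def rel_entropy_self[OF S p])
qed

text \<open>A mass function is the mixture of point masses weighted by its own values.\<close>

lemma prob_simplex_subset_hull:
  assumes S: "finite S" and vert: "\<And>s. s \<in> S \<Longrightarrow> indicator {s} \<in> X"
  shows "prob_simplex S \<subseteq> convex hull X"
proof
  fix p assume p: "p \<in> prob_simplex S"
  have "p x = (\<Sum>s\<in>S. p s *\<^sub>R (indicator {s} :: 'a \<Rightarrow> real)) x" for x
    using S p by (simp add: sum_fun_apply scaleR_fun_def indicator_def of_bool_def sum.delta
        if_distrib prob_simplex_def cong: if_cong)
  then have eq: "p = (\<Sum>s\<in>S. p s *\<^sub>R indicator {s})"
    by blast
  show "p \<in> convex hull X"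
    using p vert by (subst eq, intro convex_sum[OF S]) (auto simp: prob_simplex_def intro: hull_inc)
qed

text \<open>Once every point mass occurs among the P(S|z), the hull is the full simplex and
  \<open>proj_info\<close> is the mutual information of S and Y, a sum of nonnegative terms. A
  single term then bounds it from below.\<close>

lemma proj_info_ge:
  assumes S: "finite S" and Y: "finite Y" and P: "P \<in> prob_simplex (S \<times> Y \<times> Z)"
    and vert: "\<And>s. s \<in> S \<Longrightarrow> \<exists>z\<in>Z. marg3 S Y P z > 0 \<and> cond13 S Y P z = indicator {s}"
    and y: "y \<in> Y" "marg2 S Z P y > 0"
  shows "marg2 S Z P y * real_of_ereal (rel_entropy S (cond12 S Z P y) (marg1 Y Z P))
    \<le> proj_info S Y Z P"
proof -
  have sub: "prob_simplex S \<subseteq> convex hull (cond13 S Y P ` {z\<in>Z. marg3 S Y P z > 0})"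
    using S
  proof (rule prob_simplex_subset_hull)
    fix s assume "s \<in> S"
    then obtain z where "z \<in> Z" "marg3 S Y P z > 0" "cond13 S Y P z = indicator {s}"
      using vert by blast
    then show "indicator {s} \<in> cond13 S Y P ` {z\<in>Z. marg3 S Y P z > 0}"
      by (metis (mono_tags, lifting) imageI mem_Collect_eq)
  qed
  have at: "proj_info_at S Y Z P y = real_of_ereal (rel_entropy S (cond12 S Z P y) (marg1 Y Z P))"
    if "y \<in> Y" "marg2 S Z P y > 0" for y
    using that sub cond12_prob_simplex[OF P that]
    by (intro proj_info_at_eq_rel_entropy S P) auto
  have nn: "0 \<le> proj_info_at S Y Z P y" if "y \<in> Y" "marg2 S Z P y > 0" for y
    using rel_entropy_nonneg[OF S cond12_prob_simplex[OF P that] marg1_prob_simplex[OF P]]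
    by (simp add: at[OF that] real_of_ereal_pos)
  have "marg2 S Z P y * proj_info_at S Y Z P y \<le> proj_info S Y Z P"
    unfolding proj_info_def using Y y nn by (intro member_le_sum) auto
  then show ?thesis
    by (simp add: at[OF y])
qed

section \<open>Exchanging Y and Z\<close>

lemma swap_prob_simplex:
  assumes "P \<in> prob_simplex (S \<times> Y \<times> Z)"
  shows "(\<lambda>(s, z, y). P (s, y, z)) \<in> prob_simplex (S \<times> Z \<times> Y)"
proof -
  have "(\<Sum>s\<in>S. \<Sum>z\<in>Z. \<Sum>y\<in>Y. P (s, y, z)) = (\<Sum>s\<in>S. \<Sum>y\<in>Y. \<Sum>z\<in>Z. P (s, y, z))"
    by (intro sum.cong refl sum.swap)
  then show ?thesis
    using assms unfolding prob_simplex_def sum_prod3 by auto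
qed

text \<open>Carries bounds on \<open>proj_info\<close> over to the second argument of the minimum in
  \<open>SI_red\<close>.\<close>

lemma swap_marg:
  "marg1 Z Y (\<lambda>(s, z, y). P (s, y, z)) = marg1 Y Z P"
  "marg2 S Y (\<lambda>(s, z, y). P (s, y, z)) = marg3 S Y P"
  "marg3 S Z (\<lambda>(s, z, y). P (s, y, z)) = marg2 S Z P"
  "cond12 S Y (\<lambda>(s, z, y). P (s, y, z)) = cond13 S Y P"
  "cond13 S Z (\<lambda>(s, z, y). P (s, y, z)) = cond12 S Z P"
  by (auto simp: fun_eq_iff marg1_def marg2_def marg3_def cond12_def cond13_def intro: sum.swap)

section \<open>The witness family\<close>

text \<open>
  With probability \<open>1 - e\<close> the pair \<open>(y, z)\<close> consists of independent uniform bits and \<open>s\<close> is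
  \<open>y\<close> if \<open>z = 0\<close> and \<open>2\<close> otherwise; with probability \<open>e\<close> both \<open>y\<close> and \<open>z\<close> equal \<open>s + 2\<close>.
\<close>

definition witness :: "real \<Rightarrow> nat \<times> nat \<times> nat \<Rightarrow> real"
  where "witness e x =
    (1 - e) / 4 * indicator {(0, 0, 0), (1, 1, 0), (2, 0, 1), (2, 1, 1)} x
    + e / 4 * indicator {(0, 2, 2), (1, 3, 3)} x + e / 2 * indicator {(2, 4, 4)} x"

abbreviation "S3 \<equiv> {0, 1, 2 :: nat}"
abbreviation "Y5 \<equiv> {0, 1, 2, 3, 4 :: nat}"

lemma sum_S3: "sum f S3 = f 0 + f 1 + f 2" for f :: "nat \<Rightarrow> real"
  by simp

lemma sum_Y5: "sum f Y5 = f 0 + f 1 + f 2 + f 3 + f 4" for f :: "nat \<Rightarrow> real"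
  by simp

text \<open>The weights \<open>e / 4\<close>, \<open>e / 4\<close>, \<open>e / 2\<close> of the
  revealing part are proportional to the law of S in the other part. Hence P(S) does not depend on
  \<open>e\<close>, and the divergences computed from it below are constant.\<close>

lemma marg_witness:
  "marg1 Y5 Y5 (witness e) 0 = 1 / 4" "marg1 Y5 Y5 (witness e) 1 = 1 / 4"
  "marg1 Y5 Y5 (witness e) 2 = 1 / 2"
  "marg2 S3 Y5 (witness e) 0 = (1 - e) / 2" "marg2 S3 Y5 (witness e) 1 = (1 - e) / 2"
  "marg2 S3 Y5 (witness e) 2 = e / 4" "marg2 S3 Y5 (witness e) 3 = e / 4"
  "marg2 S3 Y5 (witness e) 4 = e / 2"
  "marg3 S3 Y5 (witness e) 0 = (1 - e) / 2" "marg3 S3 Y5 (witness e) 1 = (1 - e) / 2"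
  "marg3 S3 Y5 (witness e) 2 = e / 4" "marg3 S3 Y5 (witness e) 3 = e / 4"
  "marg3 S3 Y5 (witness e) 4 = e / 2"
  unfolding marg1_def marg2_def marg3_def sum_S3 sum_Y5 witness_def
  by (simp_all add: field_simps)

lemma cond_witness:
  assumes "e \<noteq> 1"
  shows "cond12 S3 Y5 (witness e) 0 0 = 1 / 2" "cond12 S3 Y5 (witness e) 0 1 = 0"
    "cond12 S3 Y5 (witness e) 0 2 = 1 / 2"
    "cond12 S3 Y5 (witness e) 1 0 = 0" "cond12 S3 Y5 (witness e) 1 1 = 1 / 2"
    "cond12 S3 Y5 (witness e) 1 2 = 1 / 2"
    "cond13 S3 Y5 (witness e) 0 0 = 1 / 2" "cond13 S3 Y5 (witness e) 0 1 = 1 / 2"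
    "cond13 S3 Y5 (witness e) 0 2 = 0"
    "cond13 S3 Y5 (witness e) 1 0 = 0" "cond13 S3 Y5 (witness e) 1 1 = 0"
    "cond13 S3 Y5 (witness e) 1 2 = 1"
  using assms unfolding cond12_def cond13_def marg_witness sum_Y5 witness_def
  by (simp_all add: field_simps)

text \<open>The source of the jump: for arbitrarily small positive \<open>e\<close> all vertices of
  the simplex occur as conditionals, whereas at \<open>e = 0\<close> the values \<open>2\<close>,
  \<open>3\<close>, \<open>4\<close> have probability zero.\<close>

lemma cond_witness_vertex:
  assumes "e \<noteq> 0"
  shows "cond12 S3 Y5 (witness e) 2 = indicator {0}" "cond12 S3 Y5 (witness e) 3 = indicator {1}"
    "cond12 S3 Y5 (witness e) 4 = indicator {2}"
    "cond13 S3 Y5 (witness e) 2 = indicator {0}" "cond13 S3 Y5 (witness e) 3 = indicator {1}"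
    "cond13 S3 Y5 (witness e) 4 = indicator {2}"
  using assms unfolding fun_eq_iff cond12_def cond13_def marg_witness sum_Y5 witness_def
  by (simp_all add: indicator_def)

lemma witness_prob_simplex:
  assumes "0 \<le> e" "e \<le> 1"
  shows "witness e \<in> prob_simplex (S3 \<times> Y5 \<times> Y5)"
proof -
  have "0 \<le> witness e x" for x
    using assms by (simp add: witness_def)
  moreover have "witness e x = 0" if "x \<notin> S3 \<times> Y5 \<times> Y5" for x
    using that by (auto simp: witness_def indicator_def)
  moreover have "(\<Sum>x\<in>S3 \<times> Y5 \<times> Y5. witness e x) = 1"
    \<comment> \<open>Folding the inner sums into \<open>marg1\<close> reduces the total mass to
      \<open>1 / 4 + 1 / 4 + 1 / 2\<close>.\<close>
    by (simp add: sum_prod3 marg_witness sum_S3 flip: marg1_def del: sum.insert insert_Times_insert One_nat_def)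
  ultimately show ?thesis
    unfolding prob_simplex_def by blast
qed

section \<open>\<open>SI_red\<close> at the limit point and along the family\<close>

text \<open>An upper bound on one argument of the minimum suffices, so only the projection of Y is
  computed.\<close>

lemma SI_red_witness_0: "SI_red S3 Y5 Y5 (witness 0) \<le> 0"
proof -
  have "proj_info_at S3 Y5 Y5 (witness 0) y = 0" if y: "y \<in> Y5" "marg2 S3 Y5 (witness 0) y > 0" for y
  proof (rule proj_info_at_eq_0[OF _ _ _ _ y])
    fix z assume z: "z \<in> Y5" "marg3 S3 Y5 (witness 0) z > 0"
    have "y = 0 \<or> y = 1"
      using y marg_witness[of 0] by (auto simp del: One_nat_def)
    moreover have "z = 0 \<or> z = 1"
      using z marg_witness[of 0] by (auto simp del: One_nat_def)
    ultimately show "(\<Sum>s\<in>S3. cond12 S3 Y5 (witness 0) y s * cond13 S3 Y5 (witness 0) z s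
        / marg1 Y5 Y5 (witness 0) s) \<le> 1"
      unfolding sum_S3
      \<comment> \<open>In each of the four cases the sum is exactly \<open>1\<close>, the
        orthogonality built into the witness.\<close>
      by (elim disjE) (simp_all add: cond_witness marg_witness del: One_nat_def)
  qed (simp_all only: finite.intros witness_prob_simplex order_refl zero_le_one)
  then have "proj_info S3 Y5 Y5 (witness 0) = 0"
    unfolding proj_info_def by (intro sum.neutral ballI, elim CollectE conjE) (simp only: mult_zero_right)
  then show ?thesis
    by (simp add: SI_red_def)
qed

text \<open>The value \<open>0\<close> of Y and of Z, each of probability
  \<open>(1 - e) / 2\<close>, already contributes enough: its divergence from P(S) is
  \<open>1 / 2\<close> bit for Y and \<open>1\<close> bit for Z. The smaller product is the claimed
  bound.\<close>

lemma SI_red_witness_ge: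
  assumes e: "0 < e" "e < 1"
  shows "(1 - e) / 4 \<le> SI_red S3 Y5 Y5 (witness e)"
proof -
  let ?P' = "\<lambda>(s, z, y). witness e (s, y, z)"
  have P: "witness e \<in> prob_simplex (S3 \<times> Y5 \<times> Y5)"
    using e by (intro witness_prob_simplex) auto
  have e': "e \<noteq> 0" "e \<noteq> 1"
    using e by auto
  note m = marg_witness[of e] and c = cond_witness[OF e'(2)] and v = cond_witness_vertex[OF e'(1)]
  \<comment> \<open>The laws are (1/2, 0, 1/2) and (1/4, 1/4, 1/2); only \<open>s = 0\<close>
    contributes, by \<open>1 / 2 * log 2 2\<close>.\<close>
  have "rel_entropy S3 (cond12 S3 Y5 (witness e) 0) (marg1 Y5 Y5 (witness e)) = ereal (1 / 2)"
    by (subst rel_entropy_finite) (auto simp add: m c sum_S3 simp del: One_nat_def)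
  moreover have "\<exists>z\<in>Y5. 0 < marg3 S3 Y5 (witness e) z \<and> cond13 S3 Y5 (witness e) z = indicator {s}"
    if "s \<in> S3" for s
    using that m v e by (auto simp del: One_nat_def)
  ultimately have Y: "(1 - e) / 2 * (1 / 2) \<le> proj_info S3 Y5 Y5 (witness e)"
    using proj_info_ge[OF _ _ P, of 0] e by (simp add: m del: One_nat_def)
  \<comment> \<open>Here (1/2, 1/2, 0) doubles the mass of P(S) wherever it is positive.\<close>
  have "rel_entropy S3 (cond13 S3 Y5 (witness e) 0) (marg1 Y5 Y5 (witness e)) = ereal 1"
    by (subst rel_entropy_finite) (auto simp add: m c sum_S3 simp del: One_nat_def)
  moreover have "\<exists>z\<in>Y5. 0 < marg2 S3 Y5 (witness e) z \<and> cond12 S3 Y5 (witness e) z = indicator {s}"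
    if "s \<in> S3" for s
    using that m v e by (auto simp del: One_nat_def)
  ultimately have "(1 - e) / 2 * 1 \<le> proj_info S3 Y5 Y5 ?P'"
    using proj_info_ge[OF _ _ swap_prob_simplex[OF P], of 0] e
    unfolding swap_marg by (simp add: m del: One_nat_def)
  then show ?thesis
    using Y e by (simp add: SI_red_def)
qed

section \<open>Discontinuity at the limit point\<close>

theorem lemma2:
  shows "\<exists>(S :: nat set) (Y :: nat set) (Z :: nat set).
    finite S \<and> finite Y \<and> finite Z \<and>
    \<not> continuous_on (prob_simplex (S \<times> Y \<times> Z)) (SI_red S Y Z)"
proof (intro exI conjI notI)
  assume cont: "continuous_on (prob_simplex (S3 \<times> Y5 \<times> Y5)) (SI_red S3 Y5 Y5)"
  \<comment> \<open>In the product topology continuity is coordinatewise, and each coordinate is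
    affine in \<open>e\<close>.\<close>
  have "continuous_on {0..1} witness"
  proof (rule continuous_on_coordinatewise_then_product)
    show "continuous_on {0..1} (\<lambda>e. witness e x)" for x
      unfolding witness_def by (intro continuous_intros) auto
  qed
  then have "continuous_on {0..1} (\<lambda>e. SI_red S3 Y5 Y5 (witness e))"
    by (rule continuous_on_compose2[OF cont]) (intro image_subsetI witness_prob_simplex; simp)
  \<comment> \<open>The lower bound is available only for positive \<open>e\<close>, hence the limit
    from the right; it forces \<open>1 / 4 \<le> 0\<close>.\<close>
  then have "((\<lambda>e. SI_red S3 Y5 Y5 (witness e)) \<longlongrightarrow> SI_red S3 Y5 Y5 (witness 0)) (at_right 0)"
    by (rule continuous_on_Icc_at_rightD) simp
  moreover have "((\<lambda>e::real. (1 - e) / 4) \<longlongrightarrow> (1 - 0) / 4) (at_right 0)"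
    by (intro tendsto_intros) auto
  moreover have "\<forall>\<^sub>F e::real in at_right 0. (1 - e) / 4 \<le> SI_red S3 Y5 Y5 (witness e)"
    unfolding eventually_at_right_field
    by (intro exI[of _ 1] conjI allI impI SI_red_witness_ge zero_less_one)
  ultimately have "(1 - 0) / 4 \<le> SI_red S3 Y5 Y5 (witness 0)"
    by (rule tendsto_le[OF trivial_limit_at_right_real])
  then show False
    using SI_red_witness_0 by simp
qed auto

end
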